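(* Fix $\alpha\in(0,1)$. For each $n$, let $P_1,\dots,P_n$ be independent $[0,1]$-valued P-values with set of true nulls $\mathcal{I}_0\subset\{1,\dots,n\}$, $n_0=\#\mathcal{I}_0$, $n_1=n-n_0$. Assume that $n_0/n\to\pi_0\in(0,1)$ as $n\to\infty$, and that there is a continuous distribution function $G$ on the real line such that, for any fixed $0\le s<t\le 1$, almost surely, $$\lim_{n\to\infty}\frac{V(s,t)}{n_0}=t-s,\qquad \lim_{n\to\infty}\frac{S(s,t)}{n_1}=G(t)-G(s).$$ Let $\beta=\frac{1}{\pi_1}\left(\frac1\alpha-\pi_0\right)$ with $\pi_1=1-\pi_0$, and let $\delta$ and $\mathcal{A}$ be the value and the set of maximizers of the problem of maximizing $t-s$ subject to $\overline{\mathrm{FDR}}^\infty(s,t)\le\alpha$. Assume that $\delta>0$ and that there is $(s,t)\in\mathcal{A}$ such that $u\mapsto\overline{\mathrm{FDR}}^\infty(u,t)$ is strictly decreasing at $u=s$ or $u\mapsto\overline{\mathrm{FDR}}^\infty(s,u)$ is strictly increasing at $u=t$. Let $(\hat\sigma_n,\hat\tau_n)$ be the endpoints of the interval selected by the scan procedure at level $\alpha$. Then $$\lim_{n\to\infty}\mathbb{E}\big[\mathrm{FNP}(\hat\sigma_n,\hat\tau_n)\big]=1-\beta\delta.$$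
   Context: For $0\le s\le t\le 1$ (dependence on $n$ implicit): $V(s,t)=\#\{i\in\mathcal{I}_0: s\le P_i\le t\}$, $S(s,t)=\#\{i\notin\mathcal{I}_0: s\le P_i\le t\}$, $R(s,t)=V(s,t)+S(s,t)$, and $\widehat{\mathrm{FDR}}(s,t)=\frac{n(t-s)}{R(s,t)\vee 1}$, where $a\vee b=\max(a,b)$. The scan procedure at level $\alpha$ rejects the null hypotheses with P-values in $[\hat\sigma_n,\hat\tau_n]$, where $(\hat\sigma_n,\hat\tau_n)$ is a maximizer of $t-s$ over all $0\le s\le t\le1$ with $\widehat{\mathrm{FDR}}(s,t)\le\alpha$; if there are several maximizing intervals, the left-most one is chosen. The false non-discovery proportion of a procedure is the number of false nulls not rejected divided by $n_1$; for rejection region $[s,t]$ it is $\mathrm{FNP}(s,t)=1-S(s,t)/n_1$. $\mathrm{FNP}(\hat\sigma_n,\hat\tau_n)$ is its value at $(s,t)=(\hat\sigma_n,\hat\tau_n)$. For $0\le s<t\le 1$, $$\overline{\mathrm{FDR}}^\infty(s,t)=\frac{t-s}{\pi_0(t-s)+\pi_1(G(t)-G(s))}.$$ $\delta=\max\{t-s:\overline{\mathrm{FDR}}^\infty(s,t)\le\alpha\}$, or equivalently $\delta=\max\{t-s: G(t)-G(s)=\beta(t-s)\}$; $\mathcal{A}$ is the set of $(s,t)$, $0\le s\le t\le 1$, attaining this maximum. "Strictly decreasing at $u=s$" means: there is $\varepsilon>0$ with $\overline{\mathrm{FDR}}^\infty(u,t)<\overline{\mathrm{FDR}}^\infty(s,t)$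 for $s<u\le s+\varepsilon$. "Strictly increasing at $u=t$" means: there is $\varepsilon>0$ with $\overline{\mathrm{FDR}}^\infty(s,u)<\overline{\mathrm{FDR}}^\infty(s,t)$ for $t-\varepsilon\le u<t$. *)

theory Defs
  imports "HOL-Probability.Probability"
begin

text \<open>
  Hypotheses are indexed by \<open>{1..n}\<close>; \<open>I0\<close> is the set of true nulls and
  \<open>p i\<close> is the realised P-value of hypothesis \<open>i\<close>.
\<close>

definition true_null_count :: "nat set \<Rightarrow> (nat \<Rightarrow> real) \<Rightarrow> real \<Rightarrow> real \<Rightarrow> nat" where
  "true_null_count I0 p s t = card {i \<in> I0. s \<le> p i \<and> p i \<le> t}"

definition false_null_count ::
  "nat \<Rightarrow> nat set \<Rightarrow> (nat \<Rightarrow> real) \<Rightarrow> real \<Rightarrow> real \<Rightarrow> nat" where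
  "false_null_count n I0 p s t = card {i \<in> {1..n} - I0. s \<le> p i \<and> p i \<le> t}"

definition rejection_count ::
  "nat \<Rightarrow> nat set \<Rightarrow> (nat \<Rightarrow> real) \<Rightarrow> real \<Rightarrow> real \<Rightarrow> nat" where
  "rejection_count n I0 p s t = true_null_count I0 p s t + false_null_count n I0 p s t"

definition FDR_hat ::
  "nat \<Rightarrow> nat set \<Rightarrow> (nat \<Rightarrow> real) \<Rightarrow> real \<Rightarrow> real \<Rightarrow> real" where
  "FDR_hat n I0 p s t = real n * (t - s) / real (max (rejection_count n I0 p s t) 1)"

definition scan_feasible ::
  "real \<Rightarrow> nat \<Rightarrow> nat set \<Rightarrow> (nat \<Rightarrow> real) \<Rightarrow> (real \<times> real) set" where
  "scan_feasible \<alpha> n I0 p =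
     {(s, t). 0 \<le> s \<and> s \<le> t \<and> t \<le> 1 \<and> FDR_hat n I0 p s t \<le> \<alpha>}"

definition is_scan_interval ::
  "real \<Rightarrow> nat \<Rightarrow> nat set \<Rightarrow> (nat \<Rightarrow> real) \<Rightarrow> real \<Rightarrow> real \<Rightarrow> bool" where
  "is_scan_interval \<alpha> n I0 p s t \<longleftrightarrow>
     (s, t) \<in> scan_feasible \<alpha> n I0 p \<and>
     (\<forall>(s', t') \<in> scan_feasible \<alpha> n I0 p.
        t' - s' \<le> t - s \<and> (t' - s' = t - s \<longrightarrow> s \<le> s'))"

text \<open>The description is proper by \<open>scan_interval_ex1\<close> below.\<close>

definition scan_interval ::
  "real \<Rightarrow> nat \<Rightarrow> nat set \<Rightarrow> (nat \<Rightarrow> real) \<Rightarrow> real \<times> real" where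
  "scan_interval \<alpha> n I0 p = (THE (s, t). is_scan_interval \<alpha> n I0 p s t)"

definition FNP :: "nat \<Rightarrow> nat set \<Rightarrow> (nat \<Rightarrow> real) \<Rightarrow> real \<times> real \<Rightarrow> real" where
  "FNP n I0 p = (\<lambda>(s, t). 1 - real (false_null_count n I0 p s t) / real (n - card I0))"

text \<open>
  On the diagonal \<open>s = t\<close> the following quotient is \<open>0 / 0 = 0\<close>, so degenerate intervals
  satisfy the constraint \<open>FDR_inf \<pi>0 G s t \<le> \<alpha>\<close> and contribute length \<open>0\<close>; they are
  irrelevant as soon as the maximal length is positive.
\<close>

definition FDR_inf :: "real \<Rightarrow> (real \<Rightarrow> real) \<Rightarrow> real \<Rightarrow> real \<Rightarrow> real" where
  "FDR_inf \<pi>0 G s t = (t - s) / (\<pi>0 * (t - s) + (1 - \<pi>0) * (G t - G s))"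

definition limit_feasible ::
  "real \<Rightarrow> real \<Rightarrow> (real \<Rightarrow> real) \<Rightarrow> (real \<times> real) set" where
  "limit_feasible \<alpha> \<pi>0 G = {(s, t). 0 \<le> s \<and> s \<le> t \<and> t \<le> 1 \<and> FDR_inf \<pi>0 G s t \<le> \<alpha>}"

text \<open>
  \<open>Greatest\<close> is the (attained) maximum; it exists by \<open>limit_length_max\<close> below.
\<close>

definition limit_length :: "real \<Rightarrow> real \<Rightarrow> (real \<Rightarrow> real) \<Rightarrow> real" where
  "limit_length \<alpha> \<pi>0 G = (GREATEST d. \<exists>(s, t) \<in> limit_feasible \<alpha> \<pi>0 G. d = t - s)"

definition limit_maximizers ::
  "real \<Rightarrow> real \<Rightarrow> (real \<Rightarrow> real) \<Rightarrow> (real \<times> real) set" where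
  "limit_maximizers \<alpha> \<pi>0 G =
     {(s, t) \<in> limit_feasible \<alpha> \<pi>0 G. t - s = limit_length \<alpha> \<pi>0 G}"

definition strictly_decreasing_at :: "(real \<Rightarrow> real) \<Rightarrow> real \<Rightarrow> bool" where
  "strictly_decreasing_at f x \<longleftrightarrow> (\<exists>\<epsilon>>0. \<forall>u. x < u \<and> u \<le> x + \<epsilon> \<longrightarrow> f u < f x)"

definition strictly_increasing_at :: "(real \<Rightarrow> real) \<Rightarrow> real \<Rightarrow> bool" where
  "strictly_increasing_at f x \<longleftrightarrow> (\<exists>\<epsilon>>0. \<forall>u. x - \<epsilon> \<le> u \<and> u < x \<longrightarrow> f u < f x)"

lemma scan_feasible_compact:
  assumes "I0 \<subseteq> {1..n}"
  shows "compact (scan_feasible \<alpha> n I0 p)"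
proof -
  let ?T = "{z::real \<times> real. 0 \<le> fst z \<and> fst z \<le> snd z \<and> snd z \<le> 1}"
  let ?B = "\<lambda>J. ?T \<inter> (\<Inter>j\<in>J. {z. fst z \<le> p j \<and> p j \<le> snd z}) \<inter>
      {z. real n * (snd z - fst z) / real (max (card J) 1) \<le> \<alpha>}"
  have fin: "finite I0"
    using assms finite_subset by blast
  have R: "rejection_count n I0 p s t = card {i \<in> {1..n}. s \<le> p i \<and> p i \<le> t}" for s t
  proof -
    have "{i \<in> {1..n}. s \<le> p i \<and> p i \<le> t} =
        {i \<in> I0. s \<le> p i \<and> p i \<le> t} \<union> {i \<in> {1..n} - I0. s \<le> p i \<and> p i \<le> t}"
      using assms by auto
    then show ?thesis
      unfolding rejection_count_def true_null_count_def false_null_count_def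
      using fin by (subst card_Un_disjoint[symmetric]) auto
  qed
  have eq: "scan_feasible \<alpha> n I0 p = (\<Union>J\<in>Pow {1..n}. ?B J)"
  proof (intro equalityI subsetI)
    fix z assume "z \<in> scan_feasible \<alpha> n I0 p"
    then have "z \<in> ?B {i \<in> {1..n}. fst z \<le> p i \<and> p i \<le> snd z}"
      by (auto simp: scan_feasible_def FDR_hat_def R)
    then show "z \<in> (\<Union>J\<in>Pow {1..n}. ?B J)"
      by (intro UN_I[where a = "{i \<in> {1..n}. fst z \<le> p i \<and> p i \<le> snd z}"]) auto
  next
    fix z assume "z \<in> (\<Union>J\<in>Pow {1..n}. ?B J)"
    then obtain J where J: "J \<subseteq> {1..n}" and z: "z \<in> ?B J"
      by blast
    have "card J \<le> rejection_count n I0 p (fst z) (snd z)"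
      unfolding R using J z by (intro card_mono) auto
    then have "real n * (snd z - fst z) / real (max (rejection_count n I0 p (fst z) (snd z)) 1)
        \<le> real n * (snd z - fst z) / real (max (card J) 1)"
      using z by (intro divide_left_mono) auto
    then show "z \<in> scan_feasible \<alpha> n I0 p"
      using z by (auto simp: scan_feasible_def FDR_hat_def split_beta)
  qed
  have "closed (?B J)" for J
    by (intro closed_Int closed_INT ballI closed_Collect_conj closed_Collect_le
        continuous_intros) auto
  then have "closed (scan_feasible \<alpha> n I0 p)"
    unfolding eq by (intro closed_UN) auto
  moreover have "scan_feasible \<alpha> n I0 p \<subseteq> {0..1} \<times> {0..1}"
    by (auto simp: scan_feasible_def)
  moreover have "bounded ({0..1::real} \<times> {0..1::real})"
    by (intro bounded_Times bounded_closed_interval)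
  ultimately show ?thesis
    unfolding compact_eq_bounded_closed using bounded_subset by blast
qed

lemma scan_interval_ex1:
  assumes "I0 \<subseteq> {1..n}" "0 \<le> \<alpha>"
  shows "\<exists>!z. case z of (s, t) \<Rightarrow> is_scan_interval \<alpha> n I0 p s t"
proof -
  let ?K = "scan_feasible \<alpha> n I0 p"
  have K: "compact ?K"
    by (rule scan_feasible_compact[OF assms(1)])
  have cont: "continuous_on A (\<lambda>z. snd z - fst z)" "continuous_on A fst" for A :: "(real \<times> real) set"
    by (intro continuous_intros)+
  have "(0, 0) \<in> ?K"
    using assms(2) by (simp add: scan_feasible_def FDR_hat_def)
  then have "?K \<noteq> {}"
    by blast
  then obtain m where m: "m \<in> ?K" "\<And>z. z \<in> ?K \<Longrightarrow> snd z - fst z \<le> snd m - fst m"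
    using continuous_attains_sup[OF K _ cont(1)] by blast
  let ?L = "?K \<inter> {z. snd z - fst z = snd m - fst m}"
  have "compact ?L"
    by (intro compact_Int_closed K closed_Collect_eq continuous_intros)
  moreover have "?L \<noteq> {}"
    using m by blast
  ultimately obtain z where z: "z \<in> ?L" "\<And>w. w \<in> ?L \<Longrightarrow> fst z \<le> fst w"
    using continuous_attains_inf[OF _ _ cont(2), of ?L] by blast
  have len: "snd z - fst z = snd m - fst m" and zK: "z \<in> ?K"
    using z(1) by auto
  have "snd w - fst w \<le> snd z - fst z \<and> (snd w - fst w = snd z - fst z \<longrightarrow> fst z \<le> fst w)"
    if "w \<in> ?K" for w
    using m(2)[OF that] z(2)[of w] that len by auto
  then have scan: "is_scan_interval \<alpha> n I0 p (fst z) (snd z)"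
    unfolding is_scan_interval_def using zK by (auto simp: split_beta)
  then show ?thesis
  proof (intro ex1I[of _ z])
    fix w assume "case w of (s, t) \<Rightarrow> is_scan_interval \<alpha> n I0 p s t"
    then have "is_scan_interval \<alpha> n I0 p (fst w) (snd w)"
      by (simp add: split_beta)
    then have "w \<in> ?K" and w: "\<And>v. v \<in> ?K \<Longrightarrow>
        snd v - fst v \<le> snd w - fst w \<and> (snd v - fst v = snd w - fst w \<longrightarrow> fst w \<le> fst v)"
      by (auto simp: is_scan_interval_def split_beta)
    moreover have "\<And>v. v \<in> ?K \<Longrightarrow>
        snd v - fst v \<le> snd z - fst z \<and> (snd v - fst v = snd z - fst z \<longrightarrow> fst z \<le> fst v)"
      using scan by (auto simp: is_scan_interval_def split_beta)
    ultimately have "snd w - fst w = snd z - fst z" "fst w = fst z"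
      using zK by (meson order.antisym)+
    then show "w = z"
      by (simp add: prod_eq_iff)
  qed (use scan in \<open>simp add: split_beta\<close>)
qed

lemma limit_length_max:
  assumes "0 < \<alpha>" "0 < \<pi>0" "\<pi>0 < 1" "mono G" "continuous_on UNIV G"
  shows "\<exists>z \<in> limit_feasible \<alpha> \<pi>0 G. limit_length \<alpha> \<pi>0 G = snd z - fst z"
    and "z \<in> limit_feasible \<alpha> \<pi>0 G \<Longrightarrow> snd z - fst z \<le> limit_length \<alpha> \<pi>0 G"
proof -
  let ?K = "limit_feasible \<alpha> \<pi>0 G"
  let ?C = "{z::real \<times> real. 0 \<le> fst z \<and> fst z \<le> snd z \<and> snd z \<le> 1 \<and> snd z - fst z \<le>
     \<alpha> * (\<pi>0 * (snd z - fst z) + (1 - \<pi>0) * (G (snd z) - G (fst z)))}"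
  have "FDR_inf \<pi>0 G s t \<le> \<alpha> \<longleftrightarrow>
      t - s \<le> \<alpha> * (\<pi>0 * (t - s) + (1 - \<pi>0) * (G t - G s))" if "s \<le> t" for s t
  proof (cases "s = t")
    case False
    have "0 \<le> (1 - \<pi>0) * (G t - G s)"
      using assms that by (simp add: monoD)
    moreover have "0 < \<pi>0 * (t - s)"
      using assms False that by simp
    ultimately show ?thesis
      by (simp add: FDR_inf_def pos_divide_le_eq)
  qed (use assms in \<open>simp add: FDR_inf_def\<close>)
  then have eq: "?K = ?C"
    by (auto simp: limit_feasible_def)
  have cont: "continuous_on A (\<lambda>z. snd z - fst z)" for A :: "(real \<times> real) set"
    by (intro continuous_intros)
  have G: "continuous_on A (\<lambda>z. G (h z))" if "continuous_on A h" for A and h :: "real \<times> real \<Rightarrow> real"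
    using continuous_on_compose2[OF assms(5) that] by simp
  have "closed ?C"
    by (intro closed_Collect_conj closed_Collect_le continuous_intros G)
  moreover have "?C \<subseteq> {0..1} \<times> {0..1}"
    by auto
  moreover have "bounded ({0..1::real} \<times> {0..1::real})"
    by (intro bounded_Times bounded_closed_interval)
  ultimately have "compact ?K"
    unfolding eq compact_eq_bounded_closed using bounded_subset by blast
  moreover have "(0, 0) \<in> ?K"
    using assms by (simp add: limit_feasible_def FDR_inf_def)
  ultimately obtain m where m: "m \<in> ?K" "\<And>z. z \<in> ?K \<Longrightarrow> snd z - fst z \<le> snd m - fst m"
    using continuous_attains_sup[OF _ _ cont, of ?K] by blast
  have "limit_length \<alpha> \<pi>0 G = snd m - fst m"
    unfolding limit_length_def
  proof (rule Greatest_equality)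
    show "\<exists>(s, t) \<in> ?K. snd m - fst m = t - s"
      using m(1) by (intro bexI[of _ m]) (simp_all add: split_beta)
    show "y \<le> snd m - fst m" if "\<exists>(s, t) \<in> ?K. y = t - s" for y
      using that m(2) by (auto simp: split_beta)
  qed
  with m show "\<exists>z \<in> ?K. limit_length \<alpha> \<pi>0 G = snd z - fst z"
    and "z \<in> ?K \<Longrightarrow> snd z - fst z \<le> limit_length \<alpha> \<pi>0 G"
    by auto
qed

end

theory Submission
  imports Defs
begin

text \<open>
  Almost surely the false non-discovery proportion of the scan interval converges to
  \<open>1 - \<beta> \<delta>\<close>; as it lies in \<open>[0, 1]\<close>, dominated convergence gives the limit of its expectation.

  For the almost sure limit, fix a realization for which the counts converge on all intervals with
  rational end points. Counts are monotone in the interval and their limits are continuous, so the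
  convergence is uniform (\<open>uniform_convergence_of_monotone_interval_functions\<close>). Write
  \<open>deficit s t = \<beta> (t - s) - (G t - G s)\<close>; the limiting constraint reads \<open>deficit s t \<le> 0\<close>.

  The empirical constraint makes the deficit of the scan interval asymptotically nonpositive. On
  intervals longer than \<open>\<delta> + \<eta>\<close> the deficit has a positive lower bound, by compactness
  (\<open>deficit_bounded_away_from_0\<close>), so the scan interval is not much longer than \<open>\<delta>\<close>. It is not
  much shorter either: the strictness assumption gives intervals of length close to \<open>\<delta>\<close> on which
  the constraint is strict (\<open>nearly_optimal_strictly_feasible\<close>), and these become feasible for the
  scan procedure.

  The proportion of false nulls that are rejected is asymptotically the increment of \<open>G\<close> over the
  scan interval. It is at least \<open>\<beta>\<close> times the length, up to an error that vanishes, because of the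
  constraint. It is at most \<open>\<beta>\<close> times the maximum of the length and \<open>\<delta>\<close>
  (\<open>G_increment_le\<close>). Both bounds tend to \<open>\<beta> \<delta>\<close>.

  Taking expectations also requires that the scan interval depends measurably on the P-values. It
  does because it is always one of finitely many explicit intervals
  (\<open>scan_interval_is_candidate\<close>).
\<close>


section \<open>Uniform convergence of interval counts\<close>

text \<open>
  The numbers \<open>j / K\<close> cut \<open>[0, 1]\<close> into \<open>K\<close> cells. The cap \<open>K - 1\<close> puts the right end point
  \<open>x = 1\<close> into the last cell, so that every point has a cell with both ends in the grid, and
  the index of the cell is monotone in \<open>x\<close>.
\<close>
lemma cell_bounds:
  fixes K :: nat and x :: real
  assumes "0 < K" "0 \<le> x" "x \<le> 1"
  defines "j \<equiv> min (nat \<lfloor>x * real K\<rfloor>) (K - 1)"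
  shows "j < K" "real j / real K \<le> x" "x \<le> real (Suc j) / real K"
proof -
  have xK: "0 \<le> x * real K" "x * real K \<le> real K"
    using assms by (simp_all add: mult_left_le_one_le)
  show "j < K"
    using assms(1) by (auto simp: j_def min_less_iff_disj)
  have "real (nat \<lfloor>x * real K\<rfloor>) \<le> x * real K"
    using xK by (simp add: of_nat_nat)
  then have "real j \<le> x * real K"
    by (auto simp: j_def min_def)
  then show "real j / real K \<le> x"
    using assms(1) by (simp add: pos_divide_le_eq)
  have "x * real K \<le> real (Suc (nat \<lfloor>x * real K\<rfloor>))"
    by linarith
  moreover have "x * real K \<le> real (Suc (K - 1))"
    using xK assms(1) by simp
  ultimately have "x * real K \<le> real (Suc j)"
    by (auto simp: j_def min_def)
  then show "x \<le> real (Suc j) / real K"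
    using assms(1) by (simp add: pos_le_divide_eq)
qed

text \<open>
  Polya's argument. Let \<open>F\<close> vary by less than \<open>e / 3\<close> over two cells of a grid. Any \<open>[s, t]\<close> lies
  between the interval that leaves out the cells of its end points and the one that includes them
  completely. On these finitely many grid intervals \<open>N\<close> is eventually within \<open>e / 3\<close> of its
  limit, and monotonicity of \<open>N\<close> carries this over to \<open>[s, t]\<close>.

  Convergence is asked for rational end points because only countably many of the almost sure
  limits can be used simultaneously.
\<close>
lemma uniform_convergence_of_monotone_interval_functions:
  fixes N :: "nat \<Rightarrow> real \<Rightarrow> real \<Rightarrow> real" and F :: "real \<Rightarrow> real"
  assumes nonneg: "\<And>n s t. 0 \<le> N n s t"
    and monoN: "\<And>n s t s' t'. 1 \<le> n \<Longrightarrow> s' \<le> s \<Longrightarrow> t \<le> t' \<Longrightarrow> N n s t \<le> N n s' t'"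
    and F: "mono F" "continuous_on {0..1} F"
    and conv: "\<And>s t. s \<in> \<rat> \<Longrightarrow> t \<in> \<rat> \<Longrightarrow> 0 \<le> s \<Longrightarrow> s < t \<Longrightarrow> t \<le> 1 \<Longrightarrow>
      (\<lambda>n. N n s t) \<longlonglongrightarrow> F t - F s"
    and e: "0 < e"
  shows "\<forall>\<^sub>F n in sequentially. \<forall>s t. 0 \<le> s \<longrightarrow> s \<le> t \<longrightarrow> t \<le> 1 \<longrightarrow>
    \<bar>N n s t - (F t - F s)\<bar> \<le> e"
proof -
  have "uniformly_continuous_on {0..1} F"
    using F(2) by (rule compact_uniformly_continuous) simp
  then obtain d where d: "0 < d"
    and osc: "\<And>x y. x \<in> {0..1} \<Longrightarrow> y \<in> {0..1} \<Longrightarrow> dist y x < d \<Longrightarrow> dist (F y) (F x) < e / 3"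
    unfolding uniformly_continuous_on_def using e by (metis divide_pos_pos zero_less_numeral)
  obtain K :: nat where K: "2 / d < real K"
    using reals_Archimedean2 by blast
  then have K0: "0 < K"
    using d by (metis divide_pos_pos gr0I not_less_iff_gr_or_eq of_nat_0 zero_less_numeral)
  have Kd: "2 / real K < d"
    using K K0 d by (simp add: field_simps)
  define g where "g j = real j / real K" for j
  have g: "g j \<in> {0..1}" if "j \<le> K" for j
    using that K0 by (simp add: g_def)
  have osc': "F y - F x < e / 3" if "x \<in> {0..1}" "y \<in> {0..1}" "\<bar>y - x\<bar> \<le> 2 / real K" for x y
  proof -
    have "dist (F y) (F x) < e / 3"
      using osc[OF that(1,2)] that(3) Kd by (simp add: dist_real_def)
    then show ?thesis
      unfolding dist_real_def by linarith
  qed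
  have "\<forall>\<^sub>F n in sequentially. \<forall>(i, j) \<in> {(i, j). i < j \<and> j \<le> K}.
      \<bar>N n (g i) (g j) - (F (g j) - F (g i))\<bar> < e / 3"
  proof (rule eventually_ball_finite)
    show "finite {(i, j). i < j \<and> j \<le> K}"
      by (rule finite_subset[of _ "{..K} \<times> {..K}"]) auto
    show "\<forall>ij\<in>{(i, j). i < j \<and> j \<le> K}. \<forall>\<^sub>F n in sequentially.
        case ij of (i, j) \<Rightarrow> \<bar>N n (g i) (g j) - (F (g j) - F (g i))\<bar> < e / 3"
    proof safe
      fix i j :: nat assume ij: "i < j" "j \<le> K"
      have "g i < g j"
        using ij K0 by (simp add: g_def divide_strict_right_mono)
      moreover have "g i \<in> \<rat>" "g j \<in> \<rat>"
        by (simp_all add: g_def)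
      ultimately have "(\<lambda>n. N n (g i) (g j)) \<longlonglongrightarrow> F (g j) - F (g i)"
        using g[of i] g[of j] ij by (intro conv) auto
      then show "\<forall>\<^sub>F n in sequentially. \<bar>N n (g i) (g j) - (F (g j) - F (g i))\<bar> < e / 3"
        using e by (auto dest!: tendstoD[where e = "e / 3"] simp: dist_real_def)
    qed
  qed
  then show ?thesis
    using eventually_ge_at_top[of "1::nat"]
  proof eventually_elim
    case (elim n)
    have grid: "N n (g i) (g j) < F (g j) - F (g i) + e / 3"
        "F (g j) - F (g i) - e / 3 < N n (g i) (g j)" if "i < j" "j \<le> K" for i j
    proof -
      have "\<bar>N n (g i) (g j) - (F (g j) - F (g i))\<bar> < e / 3"
        using elim that by auto
      then show "N n (g i) (g j) < F (g j) - F (g i) + e / 3"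
        "F (g j) - F (g i) - e / 3 < N n (g i) (g j)"
        by linarith+
    qed
    show ?case
    proof (intro allI impI)
      fix s t :: real assume st: "0 \<le> s" "s \<le> t" "t \<le> 1"
      define j where "j = min (nat \<lfloor>s * real K\<rfloor>) (K - 1)"
      define l where "l = min (nat \<lfloor>t * real K\<rfloor>) (K - 1)"
      have j: "j < K" "g j \<le> s" "s \<le> g (Suc j)"
        using cell_bounds[OF K0, of s] st unfolding j_def g_def by auto
      have l: "l < K" "g l \<le> t" "t \<le> g (Suc l)"
        using cell_bounds[OF K0, of t] st unfolding l_def g_def by auto
      have "s * real K \<le> t * real K"
        using st by (simp add: mult_right_mono)
      then have jl: "j \<le> l"
        unfolding j_def l_def by (intro min.mono nat_mono floor_mono) auto
      have step: "g (Suc i) - g i = 1 / real K" for i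
        by (simp add: g_def add_divide_distrib)
      have K12: "1 / real K \<le> 2 / real K"
        by (simp add: divide_right_mono)
      have "N n s t \<le> N n (g j) (g (Suc l))"
        using monoN[OF _ j(2) l(3)] elim by simp
      moreover have "N n (g j) (g (Suc l)) < F (g (Suc l)) - F (g j) + e / 3"
        using grid[of j "Suc l"] jl l(1) by auto
      moreover have "F (g (Suc l)) - F t < e / 3"
        using l step[of l] K12 st g[of "Suc l"] by (intro osc') auto
      moreover have "F s - F (g j) < e / 3"
        using j step[of j] K12 st g[of j] by (intro osc') auto
      ultimately have upper: "N n s t \<le> F t - F s + e"
        by simp
      have lower: "F t - F s - e \<le> N n s t"
      proof (cases "Suc j < l")
        case True
        have "N n (g (Suc j)) (g l) \<le> N n s t"
          using monoN[OF _ j(3) l(2)] elim by simp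
        moreover have "F (g l) - F (g (Suc j)) - e / 3 < N n (g (Suc j)) (g l)"
          using grid[of "Suc j" l] True l(1) by auto
        moreover have "F t - F (g l) < e / 3"
          using l step[of l] K12 st g[of l] by (intro osc') auto
        moreover have "F (g (Suc j)) - F s < e / 3"
          using j step[of j] K12 st g[of "Suc j"] by (intro osc') auto
        ultimately show ?thesis
          by simp
      next
        \<comment> \<open>No grid interval lies inside \<open>[s, t]\<close>, but then \<open>F\<close> hardly grows on it.\<close>
        case False
        then have "real (Suc l) \<le> real j + 2"
          using False by simp
        then have "g (Suc l) - g j \<le> 2 / real K"
          by (simp add: g_def flip: diff_divide_distrib) (simp add: divide_right_mono)
        then have "F t - F s < e / 3"
          using j l st by (intro osc') auto
        then show ?thesis
          using nonneg[of n s t] e by linarith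
      qed
      show "\<bar>N n s t - (F t - F s)\<bar> \<le> e"
        using upper lower by (simp add: abs_le_iff)
    qed
  qed
qed

section \<open>The limiting optimization problem\<close>
lemma interval_extension:
  fixes s t c :: real
  assumes "0 \<le> s" "s \<le> t" "t \<le> 1" "t - s \<le> c" "c \<le> 1"
  obtains s' t' where "0 \<le> s'" "s' \<le> s" "t \<le> t'" "t' \<le> 1" "t' - s' = c"
  using assms by (intro that[of "max 0 (t - c)" "max 0 (t - c) + c"]) auto

locale limit_scan_problem =
  fixes \<alpha> \<pi>0 :: real and G :: "real \<Rightarrow> real"
  assumes \<alpha>: "0 < \<alpha>" "\<alpha> < 1"
    and \<pi>0: "0 < \<pi>0" "\<pi>0 < 1"
    and G: "mono G" "continuous_on UNIV G" "G 1 - G 0 \<le> 1"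
begin

text \<open>
  The limit of \<open>R(s, t) / n\<close>, and the denominator of \<^const>\<open>FDR_inf\<close>.
\<close>
definition mass :: "real \<Rightarrow> real \<Rightarrow> real" where
  "mass s t = \<pi>0 * (t - s) + (1 - \<pi>0) * (G t - G s)"

text \<open>The constant \<open>\<beta>\<close> of the theorem.\<close>
definition slope :: real where
  "slope = 1 / (1 - \<pi>0) * (1 / \<alpha> - \<pi>0)"

text \<open>
  The amount by which \<open>G\<close> fails to grow at average rate \<^const>\<open>slope\<close> on \<open>[s, t]\<close>; the FDR
  constraint on a nondegenerate interval says that it is at most 0.
\<close>
definition deficit :: "real \<Rightarrow> real \<Rightarrow> real" where
  "deficit s t = slope * (t - s) - (G t - G s)"

abbreviation max_length :: real where
  "max_length \<equiv> limit_length \<alpha> \<pi>0 G"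

lemma slope_gt_1: "1 < slope"
proof -
  have "1 < 1 / \<alpha>"
    using \<alpha> by simp
  then have "1 - \<pi>0 < 1 / \<alpha> - \<pi>0"
    by simp
  then show ?thesis
    using \<pi>0 by (simp add: slope_def)
qed

lemma length_minus_mass: "(t - s) - \<alpha> * mass s t = \<alpha> * (1 - \<pi>0) * deficit s t"
proof -
  have "\<alpha> * (1 - \<pi>0) * slope = 1 - \<alpha> * \<pi>0"
    using \<alpha> \<pi>0 by (simp add: slope_def field_simps)
  moreover have "\<alpha> * (1 - \<pi>0) * deficit s t =
      (\<alpha> * (1 - \<pi>0) * slope) * (t - s) - \<alpha> * (1 - \<pi>0) * (G t - G s)"
    by (simp add: deficit_def right_diff_distrib)
  ultimately have "\<alpha> * (1 - \<pi>0) * deficit s t =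
      (1 - \<alpha> * \<pi>0) * (t - s) - \<alpha> * (1 - \<pi>0) * (G t - G s)"
    by simp
  then show ?thesis
    by (simp add: mass_def algebra_simps)
qed

lemma mass_pos:
  assumes "s < t"
  shows "0 < mass s t"
  using assms \<pi>0 monoD[OF G(1), of s t] by (auto simp: mass_def intro!: add_pos_nonneg)

lemma FDR_inf_le_iff:
  assumes "s < t"
  shows "FDR_inf \<pi>0 G s t \<le> \<alpha> \<longleftrightarrow> deficit s t \<le> 0"
proof -
  have "FDR_inf \<pi>0 G s t \<le> \<alpha> \<longleftrightarrow> (t - s) - \<alpha> * mass s t \<le> 0"
    using mass_pos[OF assms] by (simp add: FDR_inf_def mass_def[symmetric] pos_divide_le_eq)
  then show ?thesis
    using \<alpha> \<pi>0 by (simp add: length_minus_mass mult_le_0_iff)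
qed

lemma FDR_inf_less_iff:
  assumes "s < t"
  shows "FDR_inf \<pi>0 G s t < \<alpha> \<longleftrightarrow> t - s < \<alpha> * mass s t"
  using mass_pos[OF assms] by (simp add: FDR_inf_def mass_def[symmetric] pos_divide_less_eq)

text \<open>
  The upper bound is strict because \<^const>\<open>slope\<close> exceeds 1, while \<open>G\<close> grows by at most 1 on
  \<open>[0, 1]\<close>. It leaves room for intervals slightly longer than the maximizers.
\<close>
lemma max_length_bounds: "0 \<le> max_length" "max_length < 1"
proof -
  obtain z where z: "z \<in> limit_feasible \<alpha> \<pi>0 G" "max_length = snd z - fst z"
    using limit_length_max(1)[OF \<alpha>(1) \<pi>0 G(1,2)] by blast
  then have *: "0 \<le> fst z" "fst z \<le> snd z" "snd z \<le> 1" "FDR_inf \<pi>0 G (fst z) (snd z) \<le> \<alpha>"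
    by (auto simp: limit_feasible_def)
  then show "0 \<le> max_length"
    using z by simp
  show "max_length < 1"
  proof (rule ccontr)
    assume "\<not> max_length < 1"
    then have "fst z = 0" "snd z = 1"
      using z * by auto
    then show False
      using * FDR_inf_le_iff[of 0 1] slope_gt_1 G(3) by (simp add: deficit_def)
  qed
qed

lemma deficit_pos:
  assumes "0 \<le> s" "t \<le> 1" "max_length < t - s"
  shows "0 < deficit s t"
proof (rule ccontr)
  assume "\<not> 0 < deficit s t"
  moreover have "s < t"
    using assms max_length_bounds by linarith
  ultimately have "(s, t) \<in> limit_feasible \<alpha> \<pi>0 G"
    using assms FDR_inf_le_iff[of s t] by (auto simp: limit_feasible_def)
  then show False
    using limit_length_max(2)[OF \<alpha>(1) \<pi>0 G(1,2)] assms(3) by fastforce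
qed

text \<open>
  Longer intervals than the maximizers are infeasible, so \<open>G\<close> grows by less than \<open>slope * c\<close> on
  each interval of length \<open>c > max_length\<close>. Extend \<open>[s, t]\<close> to such an interval and let \<open>c\<close>
  decrease to \<open>max (t - s) max_length\<close>. In particular the constraint is tight at every maximizer.
\<close>
lemma G_increment_le:
  assumes st: "0 \<le> s" "s \<le> t" "t \<le> 1"
  shows "G t - G s \<le> slope * max (t - s) max_length"
proof (cases "t - s = 1")
  case True
  then have "s = 0" "t = 1"
    using st by auto
  then show ?thesis
    using G(3) slope_gt_1 max_length_bounds by simp
next
  case False
  have "max (t - s) max_length < 1"
    using False st max_length_bounds by auto
  then have "(G t - G s) / slope \<le> max (t - s) max_length"
  proof (rule dense_ge_bounded)
    fix c assume c: "max (t - s) max_length < c" "c < 1"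
    then obtain s' t' where *: "0 \<le> s'" "s' \<le> s" "t \<le> t'" "t' \<le> 1" "t' - s' = c"
      using interval_extension[OF st, of c] by auto
    then have "0 < deficit s' t'"
      using c by (intro deficit_pos) auto
    moreover have "G t - G s \<le> G t' - G s'"
      using * by (intro diff_mono monoD[OF G(1)])
    ultimately have "G t - G s \<le> slope * c"
      using *(5) by (simp add: deficit_def)
    then show "(G t - G s) / slope \<le> c"
      using slope_gt_1 by (simp add: divide_le_eq mult.commute)
  qed
  then show ?thesis
    using slope_gt_1 by (simp add: divide_le_eq mult.commute)
qed

text \<open>
  Infeasibility of too long intervals is uniform, since these intervals form a compact set. Hence
  an interval that satisfies the constraint up to a small error cannot be much longer than the
  maximizers.
\<close>
lemma deficit_bounded_away_from_0:
  assumes "0 < \<eta>"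
  obtains m where "0 < m"
    "\<And>s t. 0 \<le> s \<Longrightarrow> t \<le> 1 \<Longrightarrow> max_length + \<eta> \<le> t - s \<Longrightarrow> m \<le> deficit s t"
proof (cases "\<exists>s t. 0 \<le> s \<and> t \<le> 1 \<and> max_length + \<eta> \<le> t - s")
  case True
  let ?K = "{z::real \<times> real. 0 \<le> fst z \<and> snd z \<le> 1 \<and> max_length + \<eta> \<le> snd z - fst z}"
  have "?K \<subseteq> {0..1} \<times> {0..1}"
    using assms max_length_bounds by auto
  moreover have "bounded ({0..1::real} \<times> {0..1::real})"
    by (intro bounded_Times bounded_closed_interval)
  moreover have "closed ?K"
    by (intro closed_Collect_conj closed_Collect_le continuous_intros)
  ultimately have "compact ?K"
    unfolding compact_eq_bounded_closed using bounded_subset by blast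
  moreover have "?K \<noteq> {}"
    using True by auto
  moreover have "continuous_on ?K (\<lambda>z. deficit (fst z) (snd z))"
    unfolding deficit_def
    by (intro continuous_intros continuous_on_compose2[OF G(2)]) auto
  ultimately obtain z where z: "z \<in> ?K"
      "\<And>w. w \<in> ?K \<Longrightarrow> deficit (fst z) (snd z) \<le> deficit (fst w) (snd w)"
    using continuous_attains_inf[of ?K] by blast
  show ?thesis
  proof (rule that)
    show "0 < deficit (fst z) (snd z)"
      using z(1) assms by (intro deficit_pos) auto
    show "deficit (fst z) (snd z) \<le> deficit s t"
      if "0 \<le> s" "t \<le> 1" "max_length + \<eta> \<le> t - s" for s t
      using z(2)[of "(s, t)"] that by simp
  qed
next
  case False
  then show ?thesis
    by (intro that[of 1]) auto
qed

text \<open>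
  Strict monotonicity at one end of a maximizer means that cutting off a short piece there makes
  the constraint strict. A strict constraint survives the random fluctuations of the counts.
\<close>
lemma nearly_optimal_strictly_feasible:
  assumes strict: "\<exists>(s, t) \<in> limit_maximizers \<alpha> \<pi>0 G.
      strictly_decreasing_at (\<lambda>u. FDR_inf \<pi>0 G u t) s \<or>
      strictly_increasing_at (\<lambda>u. FDR_inf \<pi>0 G s u) t"
    and pos: "0 < max_length" and \<eta>: "0 < \<eta>"
  obtains u v where "0 \<le> u" "u < v" "v \<le> 1" "max_length - \<eta> \<le> v - u" "v - u < \<alpha> * mass u v"
proof -
  obtain s t where st: "0 \<le> s" "s \<le> t" "t \<le> 1" "FDR_inf \<pi>0 G s t \<le> \<alpha>" "t - s = max_length"
    and "strictly_decreasing_at (\<lambda>u. FDR_inf \<pi>0 G u t) s \<or>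
      strictly_increasing_at (\<lambda>u. FDR_inf \<pi>0 G s u) t"
    using strict by (auto simp: limit_maximizers_def limit_feasible_def)
  then consider "strictly_decreasing_at (\<lambda>u. FDR_inf \<pi>0 G u t) s"
    | "strictly_increasing_at (\<lambda>u. FDR_inf \<pi>0 G s u) t"
    by blast
  then show ?thesis
  proof cases
    case 1
    then obtain \<epsilon> where \<epsilon>: "0 < \<epsilon>"
      "\<And>u. s < u \<Longrightarrow> u \<le> s + \<epsilon> \<Longrightarrow> FDR_inf \<pi>0 G u t < FDR_inf \<pi>0 G s t"
      unfolding strictly_decreasing_at_def by blast
    \<comment> \<open>The term \<open>max_length / 2\<close> keeps the shortened interval nondegenerate.\<close>
    define u where "u = s + min \<epsilon> (min \<eta> (max_length / 2))"
    have u: "s < u" "u \<le> s + \<epsilon>" "u \<le> s + \<eta>" "u \<le> s + max_length / 2"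
      using \<epsilon>(1) \<eta> pos by (auto simp: u_def)
    have ut: "u < t"
      using u(4) st pos by linarith
    have "FDR_inf \<pi>0 G u t < \<alpha>"
      using \<epsilon>(2)[OF u(1,2)] st(4) by simp
    then show ?thesis
      using FDR_inf_less_iff[OF ut] u ut st by (intro that[of u t]) auto
  next
    case 2
    then obtain \<epsilon> where \<epsilon>: "0 < \<epsilon>"
      "\<And>u. t - \<epsilon> \<le> u \<Longrightarrow> u < t \<Longrightarrow> FDR_inf \<pi>0 G s u < FDR_inf \<pi>0 G s t"
      unfolding strictly_increasing_at_def by blast
    define u where "u = t - min \<epsilon> (min \<eta> (max_length / 2))"
    have u: "u < t" "t - \<epsilon> \<le> u" "t - \<eta> \<le> u" "t - max_length / 2 \<le> u"
      using \<epsilon>(1) \<eta> pos by (auto simp: u_def)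
    have su: "s < u"
      using u(4) st pos by linarith
    have "FDR_inf \<pi>0 G s u < \<alpha>"
      using \<epsilon>(2)[OF u(2,1)] st(4) by simp
    then show ?thesis
      using FDR_inf_less_iff[OF su] u su st by (intro that[of s u]) auto
  qed
qed

end


section \<open>The scan interval in the limit\<close>
lemma rejection_count_le:
  assumes "I0 \<subseteq> {1..n}"
    and "\<And>i. i \<in> {1..n} \<Longrightarrow> s \<le> p i \<Longrightarrow> p i \<le> t \<Longrightarrow> s' \<le> p i \<and> p i \<le> t'"
  shows "rejection_count n I0 p s t \<le> rejection_count n I0 p s' t'"
proof -
  have "finite I0"
    using assms(1) finite_subset by blast
  then show ?thesis
    unfolding rejection_count_def true_null_count_def false_null_count_def
    using assms by (intro add_mono card_mono) auto
qed

lemma false_null_count_le: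
  assumes "s' \<le> s" "t \<le> t'"
  shows "false_null_count n I0 p s t \<le> false_null_count n I0 p s' t'"
  unfolding false_null_count_def using assms by (intro card_mono) auto

lemma card_false_nulls:
  assumes "I0 \<subseteq> {1..n}"
  shows "card ({1..n} - I0) = n - card I0"
  using assms by (subst card_Diff_subset) (auto intro: finite_subset)

lemma true_null_count_le_card:
  assumes "I0 \<subseteq> {1..n}"
  shows "true_null_count I0 p s t \<le> card I0"
  unfolding true_null_count_def using assms
  by (intro card_mono) (auto intro: finite_subset)

lemma false_null_count_le_card:
  assumes "I0 \<subseteq> {1..n}"
  shows "false_null_count n I0 p s t \<le> n - card I0"
  unfolding false_null_count_def card_false_nulls[OF assms, symmetric]
  by (intro card_mono) auto

lemma card_true_nulls_le:
  assumes "I0 \<subseteq> {1..n}"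
  shows "card I0 \<le> n"
  using card_mono[OF _ assms] by simp

lemma rejection_count_le_n:
  assumes "I0 \<subseteq> {1..n}"
  shows "rejection_count n I0 p s t \<le> n"
  using true_null_count_le_card[OF assms, of p s t] false_null_count_le_card[OF assms, of p s t]
    card_true_nulls_le[OF assms] by (simp add: rejection_count_def)

lemma scan_feasible_iff:
  assumes "1 \<le> n"
  shows "(s, t) \<in> scan_feasible \<alpha> n I0 p \<longleftrightarrow> 0 \<le> s \<and> s \<le> t \<and> t \<le> 1 \<and>
    real n * (t - s) \<le> \<alpha> * real (max (rejection_count n I0 p s t) 1)"
  by (auto simp: scan_feasible_def FDR_hat_def pos_divide_le_eq)

lemma is_scan_interval_scan_interval:
  assumes "I0 \<subseteq> {1..n}" "0 \<le> \<alpha>"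
  shows "is_scan_interval \<alpha> n I0 p (fst (scan_interval \<alpha> n I0 p)) (snd (scan_interval \<alpha> n I0 p))"
proof -
  have "case scan_interval \<alpha> n I0 p of (s, t) \<Rightarrow> is_scan_interval \<alpha> n I0 p s t"
    unfolding scan_interval_def by (rule theI'[OF scan_interval_ex1[OF assms]])
  then show ?thesis
    by (simp add: split_beta)
qed

lemma is_scan_intervalD:
  assumes "is_scan_interval \<alpha> n I0 p s t" "(s', t') \<in> scan_feasible \<alpha> n I0 p"
  shows "t' - s' \<le> t - s" "t' - s' = t - s \<Longrightarrow> s \<le> s'"
  using assms unfolding is_scan_interval_def by auto

context limit_scan_problem
begin

text \<open>
  A statement about a single realization of the P-values. With uniform control of the counts, the
  length of the scan interval is eventually at least that of each strictly feasible limiting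
  interval, and its \<^const>\<open>deficit\<close> is eventually at most any \<open>e > 0\<close>. The first fact bounds the
  length from below and the second from above, so the length tends to \<open>max_length\<close>. The increment
  of \<open>G\<close> over the scan interval is then squeezed between \<open>slope * length - e\<close> and the bound of
  \<open>G_increment_le\<close>. The interval itself need not converge, as there may be several maximizers.
\<close>
lemma scan_interval_false_null_proportion_tendsto:
  fixes p :: "nat \<Rightarrow> nat \<Rightarrow> real" and I0 :: "nat \<Rightarrow> nat set"
  assumes I0: "\<And>n. 1 \<le> n \<Longrightarrow> I0 n \<subseteq> {1..n}"
    and R: "\<And>s t. s \<in> \<rat> \<Longrightarrow> t \<in> \<rat> \<Longrightarrow> 0 \<le> s \<Longrightarrow> s < t \<Longrightarrow> t \<le> 1 \<Longrightarrow>
      (\<lambda>n. real (rejection_count n (I0 n) (p n) s t) / real n) \<longlonglongrightarrow> mass s t"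
    and S: "\<And>s t. s \<in> \<rat> \<Longrightarrow> t \<in> \<rat> \<Longrightarrow> 0 \<le> s \<Longrightarrow> s < t \<Longrightarrow> t \<le> 1 \<Longrightarrow>
      (\<lambda>n. real (false_null_count n (I0 n) (p n) s t) / real (n - card (I0 n))) \<longlonglongrightarrow> G t - G s"
    and pos: "0 < max_length"
    and strict: "\<exists>(s, t) \<in> limit_maximizers \<alpha> \<pi>0 G.
      strictly_decreasing_at (\<lambda>u. FDR_inf \<pi>0 G u t) s \<or>
      strictly_increasing_at (\<lambda>u. FDR_inf \<pi>0 G s u) t"
  defines "\<sigma> \<equiv> \<lambda>n. fst (scan_interval \<alpha> n (I0 n) (p n))"
    and "\<tau> \<equiv> \<lambda>n. snd (scan_interval \<alpha> n (I0 n) (p n))"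
  shows "(\<lambda>n. real (false_null_count n (I0 n) (p n) (\<sigma> n) (\<tau> n)) / real (n - card (I0 n)))
    \<longlonglongrightarrow> slope * max_length"
proof -
  have scan: "is_scan_interval \<alpha> n (I0 n) (p n) (\<sigma> n) (\<tau> n)" if "1 \<le> n" for n
    unfolding \<sigma>_def \<tau>_def using is_scan_interval_scan_interval I0[OF that] \<alpha> by simp
  have feas: "0 \<le> \<sigma> n" "\<sigma> n \<le> \<tau> n" "\<tau> n \<le> 1"
      "real n * (\<tau> n - \<sigma> n) \<le> \<alpha> * real (max (rejection_count n (I0 n) (p n) (\<sigma> n) (\<tau> n)) 1)"
    if "1 \<le> n" for n
    using scan[OF that] that unfolding is_scan_interval_def
    by (simp_all add: scan_feasible_iff)

  have unifR: "\<forall>\<^sub>F n in sequentially. \<forall>s t. 0 \<le> s \<longrightarrow> s \<le> t \<longrightarrow> t \<le> 1 \<longrightarrow>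
      \<bar>real (rejection_count n (I0 n) (p n) s t) / real n - mass s t\<bar> \<le> e" if "0 < e" for e
  proof -
    let ?F = "\<lambda>x. \<pi>0 * x + (1 - \<pi>0) * G x"
    have "\<forall>\<^sub>F n in sequentially. \<forall>s t. 0 \<le> s \<longrightarrow> s \<le> t \<longrightarrow> t \<le> 1 \<longrightarrow>
      \<bar>real (rejection_count n (I0 n) (p n) s t) / real n - (?F t - ?F s)\<bar> \<le> e"
    proof (rule uniform_convergence_of_monotone_interval_functions)
      show "mono ?F"
        using \<pi>0 by (intro monoI add_mono mult_left_mono monoD[OF G(1)]) auto
      show "continuous_on {0..1} ?F"
        by (intro continuous_intros continuous_on_subset[OF G(2)]) auto
      show "(\<lambda>n. real (rejection_count n (I0 n) (p n) s t) / real n) \<longlonglongrightarrow> ?F t - ?F s"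
        if "s \<in> \<rat>" "t \<in> \<rat>" "0 \<le> s" "s < t" "t \<le> 1" for s t
        using R[OF that] by (simp add: mass_def algebra_simps)
    qed (use that in \<open>auto intro!: divide_right_mono rejection_count_le[OF I0]\<close>)
    then show ?thesis
      by (simp add: mass_def algebra_simps)
  qed
  have unifS: "\<forall>\<^sub>F n in sequentially. \<forall>s t. 0 \<le> s \<longrightarrow> s \<le> t \<longrightarrow> t \<le> 1 \<longrightarrow>
      \<bar>real (false_null_count n (I0 n) (p n) s t) / real (n - card (I0 n)) - (G t - G s)\<bar> \<le> e"
    if "0 < e" for e
    by (rule uniform_convergence_of_monotone_interval_functions)
      (use that S G in \<open>auto intro!: divide_right_mono false_null_count_le
        intro: continuous_on_subset\<close>)

  have length_ge: "\<forall>\<^sub>F n in sequentially. max_length - \<eta> \<le> \<tau> n - \<sigma> n" if "0 < \<eta>" for \<eta>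
  proof -
    obtain u v where uv: "0 \<le> u" "u < v" "v \<le> 1" "max_length - \<eta> \<le> v - u"
        "v - u < \<alpha> * mass u v"
      using nearly_optimal_strictly_feasible[OF strict pos \<open>0 < \<eta>\<close>] by metis
    have "0 < mass u v - (v - u) / \<alpha>"
      using uv(5) \<alpha> by (simp add: pos_divide_less_eq mult.commute)
    from unifR[OF this] show ?thesis
      using eventually_ge_at_top[of "1::nat"]
    proof eventually_elim
      case (elim n)
      let ?R = "real (rejection_count n (I0 n) (p n) u v)"
      have "\<bar>?R / real n - mass u v\<bar> \<le> mass u v - (v - u) / \<alpha>"
        using elim(1) uv by auto
      then have "(v - u) / \<alpha> \<le> ?R / real n"
        by linarith
      then have "real n * (v - u) \<le> \<alpha> * ?R"
        using \<alpha> elim(2) by (simp add: field_simps)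
      also have "\<dots> \<le> \<alpha> * real (max (rejection_count n (I0 n) (p n) u v) 1)"
        using \<alpha> by (intro mult_left_mono) auto
      finally have "(u, v) \<in> scan_feasible \<alpha> n (I0 n) (p n)"
        using uv elim(2) by (simp add: scan_feasible_iff)
      from is_scan_intervalD(1)[OF scan[OF elim(2)] this] show ?case
        using uv(4) by simp
    qed
  qed

  have deficit_le: "\<forall>\<^sub>F n in sequentially. deficit (\<sigma> n) (\<tau> n) \<le> e" if "0 < e" for e
  proof -
    \<comment> \<open>One \<open>e'\<close> pays for the fluctuation of \<open>R / n\<close>, the other for replacing \<open>R\<close> by \<open>max R 1\<close>.\<close>
    define e' where "e' = (1 - \<pi>0) * e / 2"
    have e': "0 < e'"
      using that \<pi>0 by (simp add: e'_def)
    have "\<forall>\<^sub>F n in sequentially. 1 / real n < e'"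
      using lim_1_over_n e' by (rule order_tendstoD)
    with unifR[OF e'] eventually_ge_at_top[of "1::nat"] show ?thesis
    proof eventually_elim
      case (elim n)
      let ?R = "rejection_count n (I0 n) (p n) (\<sigma> n) (\<tau> n)"
      note f = feas[OF elim(2)]
      have "real n * (\<tau> n - \<sigma> n) \<le> \<alpha> * real (max ?R 1)"
        by (rule f(4))
      also have "\<dots> \<le> \<alpha> * (real ?R + 1)"
        using \<alpha> by (intro mult_left_mono) auto
      finally have "\<tau> n - \<sigma> n \<le> \<alpha> * (real ?R / real n + 1 / real n)"
        using elim(2) by (simp add: field_simps)
      also have "real ?R / real n \<le> mass (\<sigma> n) (\<tau> n) + e'"
        using elim(1)[rule_format, OF f(1-3)] by linarith
      also have "1 / real n \<le> e'"
        using elim(3) by simp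
      finally have "(\<tau> n - \<sigma> n) - \<alpha> * mass (\<sigma> n) (\<tau> n) \<le> \<alpha> * (2 * e')"
        using \<alpha> by (simp add: algebra_simps)
      then have "\<alpha> * (1 - \<pi>0) * deficit (\<sigma> n) (\<tau> n) \<le> \<alpha> * (1 - \<pi>0) * e"
        by (simp add: length_minus_mass e'_def)
      then show ?case
        using \<alpha> \<pi>0 by simp
    qed
  qed

  have length_le: "\<forall>\<^sub>F n in sequentially. \<tau> n - \<sigma> n \<le> max_length + \<eta>" if "0 < \<eta>" for \<eta>
  proof -
    obtain m where m: "0 < m"
      "\<And>s t. 0 \<le> s \<Longrightarrow> t \<le> 1 \<Longrightarrow> max_length + \<eta> \<le> t - s \<Longrightarrow> m \<le> deficit s t"
      using deficit_bounded_away_from_0[OF \<open>0 < \<eta>\<close>] by metis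
    have "0 < m / 2"
      using m(1) by simp
    from deficit_le[OF this] eventually_ge_at_top[of "1::nat"] show ?thesis
    proof eventually_elim
      case (elim n)
      then show ?case
        using m(1) m(2)[of "\<sigma> n" "\<tau> n"] feas[OF elim(2)] by fastforce
    qed
  qed

  show ?thesis
  proof (rule tendstoI)
    fix e :: real assume e: "0 < e"
    define \<eta> where "\<eta> = e / (4 * slope)"
    have \<eta>: "0 < \<eta>" "slope * \<eta> = e / 4"
      using e slope_gt_1 by (auto simp: \<eta>_def)
    have e4: "0 < e / 4"
      using e by simp
    show "\<forall>\<^sub>F n in sequentially. dist
        (real (false_null_count n (I0 n) (p n) (\<sigma> n) (\<tau> n)) / real (n - card (I0 n)))
        (slope * max_length) < e"
      using unifS[OF e4] deficit_le[OF e4] length_ge[OF \<eta>(1)] length_le[OF \<eta>(1)]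
        eventually_ge_at_top[of "1::nat"]
    proof eventually_elim
      case (elim n)
      let ?q = "real (false_null_count n (I0 n) (p n) (\<sigma> n) (\<tau> n)) / real (n - card (I0 n))"
      let ?g = "G (\<tau> n) - G (\<sigma> n)"
      note f = feas[OF elim(5)]
      have q: "\<bar>?q - ?g\<bar> \<le> e / 4"
        using elim(1) f by auto
      have "?g \<le> slope * max (\<tau> n - \<sigma> n) max_length"
        using f by (intro G_increment_le) auto
      also have "\<dots> \<le> slope * (max_length + \<eta>)"
        using elim(4) \<eta>(1) slope_gt_1 by (intro mult_left_mono) auto
      finally have upper: "?g \<le> slope * max_length + e / 4"
        using \<eta>(2) by (simp add: distrib_left)
      have "slope * (max_length - \<eta>) \<le> slope * (\<tau> n - \<sigma> n)"
        using elim(3) slope_gt_1 by (intro mult_left_mono) auto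
      then have lower: "slope * max_length - e / 4 - e / 4 \<le> ?g"
        using elim(2) \<eta>(2) by (simp add: deficit_def right_diff_distrib)
      have "\<bar>x - z\<bar> < e" if "\<bar>x - y\<bar> \<le> e / 4" "y \<le> z + e / 4" "z - e / 4 - e / 4 \<le> y"
        for x y z :: real
        using that e by linarith
      from this[OF q upper lower] show ?case
        unfolding dist_real_def .
    qed
  qed
qed

end

section \<open>Measurability\<close>

text \<open>
  Intervals of length \<open>\<alpha> k / n\<close>, the largest length that \<open>k\<close> rejections can support, which either
  start at 0 (encoded by \<open>i = 0\<close>, as hypotheses are numbered from 1) or end at \<open>p i\<close>.
\<close>
definition scan_candidate ::
  "real \<Rightarrow> nat \<Rightarrow> (nat \<Rightarrow> real) \<Rightarrow> nat \<times> nat \<Rightarrow> real \<times> real" where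
  "scan_candidate \<alpha> n p = (\<lambda>(i, k).
     if i = 0 then (0, \<alpha> * real k / real n) else (p i - \<alpha> * real k / real n, p i))"

text \<open>
  By maximality the scan interval has the full length that its number of rejections supports, and
  since it is the left-most one, it cannot be shifted to the left: either it starts at 0 or the
  shift would lose a P-value at its right end point.
\<close>
lemma scan_interval_is_candidate:
  assumes n: "1 \<le> n" and \<alpha>: "0 < \<alpha>" "\<alpha> < 1" and I0: "I0 \<subseteq> {1..n}"
  shows "\<exists>a \<in> {0..n} \<times> {1..n}. scan_interval \<alpha> n I0 p = scan_candidate \<alpha> n p a"
proof -
  define s where "s = fst (scan_interval \<alpha> n I0 p)"
  define t where "t = snd (scan_interval \<alpha> n I0 p)"
  have scan: "is_scan_interval \<alpha> n I0 p s t"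
    unfolding s_def t_def using is_scan_interval_scan_interval[OF I0] \<alpha> by simp
  let ?R = "rejection_count n I0 p s t"
  define k where "k = max ?R 1"
  define c where "c = \<alpha> * real k / real n"
  have k: "k \<in> {1..n}"
    using rejection_count_le_n[OF I0] n by (auto simp: k_def)
  have "\<alpha> * real k \<le> 1 * real n"
    using k \<alpha> by (intro mult_mono) auto
  then have c: "0 < c" "c \<le> 1"
    using k n \<alpha> by (auto simp: c_def)
  have nc: "real n * c = \<alpha> * real k"
    using n by (simp add: c_def)
  have st: "0 \<le> s" "s \<le> t" "t \<le> 1" "real n * (t - s) \<le> real n * c"
    using scan n unfolding nc by (auto simp: is_scan_interval_def scan_feasible_iff k_def)
  have still_feasible: "(s', t') \<in> scan_feasible \<alpha> n I0 p"
    if "0 \<le> s'" "t' \<le> 1" "t' - s' = c" "?R \<le> rejection_count n I0 p s' t'" for s' t'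
  proof -
    have "real n * (t' - s') = \<alpha> * real k"
      using nc that(3) by simp
    also have "\<dots> \<le> \<alpha> * real (max (rejection_count n I0 p s' t') 1)"
      using \<alpha> that(4) by (intro mult_left_mono) (auto simp: k_def)
    finally show ?thesis
      using that c n by (simp add: scan_feasible_iff)
  qed
  have len: "t - s = c"
  proof (rule antisym)
    show le: "t - s \<le> c"
      using st(4) n by simp
    obtain s' t' where *: "0 \<le> s'" "s' \<le> s" "t \<le> t'" "t' \<le> 1" "t' - s' = c"
      using interval_extension[OF st(1-3) le c(2)] by metis
    have "?R \<le> rejection_count n I0 p s' t'"
      using * by (intro rejection_count_le[OF I0]) auto
    then show "c \<le> t - s"
      using is_scan_intervalD(1)[OF scan still_feasible] * by auto
  qed
  show ?thesis
  proof (cases "s = 0")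
    case True
    then have "scan_interval \<alpha> n I0 p = scan_candidate \<alpha> n p (0, k)"
      using len by (simp add: scan_candidate_def c_def s_def t_def prod_eq_iff)
    then show ?thesis
      using k by (intro bexI[of _ "(0, k)"]) auto
  next
    case False
    have "\<exists>i\<in>{1..n}. p i = t"
    proof (rule ccontr)
      assume no: "\<not> ?thesis"
      \<comment> \<open>Then the interval can be moved to the left without losing a point.\<close>
      define D where "D = insert s ((\<lambda>i. t - p i) ` {i \<in> {1..n}. p i < t})"
      have D: "finite D" "D \<noteq> {}" "\<forall>x\<in>D. 0 < x"
        using False st by (auto simp: D_def)
      define e where "e = Min D"
      have e: "0 < e" "e \<le> s" "\<And>i. i \<in> {1..n} \<Longrightarrow> p i < t \<Longrightarrow> e \<le> t - p i"
        using D by (auto simp: e_def D_def)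
      have "?R \<le> rejection_count n I0 p (s - e) (t - e)"
      proof (rule rejection_count_le[OF I0])
        fix i assume i: "i \<in> {1..n}" "s \<le> p i" "p i \<le> t"
        then have "p i < t"
          using no by force
        then show "s - e \<le> p i \<and> p i \<le> t - e"
          using e(1) e(3)[OF i(1)] i by auto
      qed
      then have "(s - e, t - e) \<in> scan_feasible \<alpha> n I0 p"
        using e st len by (intro still_feasible) auto
      from is_scan_intervalD(2)[OF scan this] show False
        using e(1) by simp
    qed
    then obtain i where i: "i \<in> {1..n}" "p i = t"
      by blast
    then have "scan_interval \<alpha> n I0 p = scan_candidate \<alpha> n p (i, k)"
      using len by (auto simp: scan_candidate_def c_def s_def t_def prod_eq_iff)
    then show ?thesis
      using k i by (intro bexI[of _ "(i, k)"]) auto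
  qed
qed

lemma borel_measurable_interval_count:
  fixes p :: "nat \<Rightarrow> 'a \<Rightarrow> real"
  assumes "finite A" and [measurable]: "s \<in> borel_measurable M" "t \<in> borel_measurable M"
    and p: "\<And>i. i \<in> A \<Longrightarrow> p i \<in> borel_measurable M"
  shows "(\<lambda>\<omega>. real (card {i \<in> A. s \<omega> \<le> p i \<omega> \<and> p i \<omega> \<le> t \<omega>})) \<in> borel_measurable M"
proof -
  have "real (card {i \<in> A. s \<omega> \<le> p i \<omega> \<and> p i \<omega> \<le> t \<omega>}) =
      (\<Sum>i\<in>A. if s \<omega> \<le> p i \<omega> \<and> p i \<omega> \<le> t \<omega> then 1 else 0)" for \<omega>
    using assms(1) by (simp add: sum.inter_filter[symmetric])
  moreover have "(\<lambda>\<omega>. \<Sum>i\<in>A. if s \<omega> \<le> p i \<omega> \<and> p i \<omega> \<le> t \<omega> then 1 else 0 :: real)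
      \<in> borel_measurable M"
  proof (rule borel_measurable_sum)
    fix i assume "i \<in> A"
    note [measurable] = p[OF this]
    show "(\<lambda>\<omega>. if s \<omega> \<le> p i \<omega> \<and> p i \<omega> \<le> t \<omega> then 1 else 0 :: real) \<in> borel_measurable M"
      by measurable
  qed
  ultimately show ?thesis
    by simp
qed

text \<open>
  The scan interval is defined by a description over an uncountable set of intervals, but it is
  one of finitely many candidates whose end points are measurable. It is the candidate that is
  feasible and not beaten by another feasible candidate; this covers the space by finitely many
  measurable pieces \<open>E a\<close>, and on each piece the scan interval is one fixed candidate.
\<close>
lemma borel_measurable_FNP_scan_interval:
  fixes p :: "nat \<Rightarrow> 'a \<Rightarrow> real"
  assumes n: "1 \<le> n" and \<alpha>: "0 < \<alpha>" "\<alpha> < 1" and I0: "I0 \<subseteq> {1..n}"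
    and p: "\<And>i. i \<in> {1..n} \<Longrightarrow> p i \<in> borel_measurable M"
  shows "(\<lambda>\<omega>. FNP n I0 (\<lambda>i. p i \<omega>) (scan_interval \<alpha> n I0 (\<lambda>i. p i \<omega>))) \<in> borel_measurable M"
proof -
  let ?I = "{0..n} \<times> {1..n}"
  define s where "s a \<omega> = fst (scan_candidate \<alpha> n (\<lambda>i. p i \<omega>) a)" for a \<omega>
  define t where "t a \<omega> = snd (scan_candidate \<alpha> n (\<lambda>i. p i \<omega>) a)" for a \<omega>
  define feas where "feas a \<omega> \<longleftrightarrow> (s a \<omega>, t a \<omega>) \<in> scan_feasible \<alpha> n I0 (\<lambda>i. p i \<omega>)" for a \<omega>
  define E where "E a = {\<omega> \<in> space M. feas a \<omega> \<and> (\<forall>b\<in>?I. feas b \<omega> \<longrightarrow>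
      t b \<omega> - s b \<omega> \<le> t a \<omega> - s a \<omega> \<and> (t b \<omega> - s b \<omega> = t a \<omega> - s a \<omega> \<longrightarrow> s a \<omega> \<le> s b \<omega>))}" for a

  have st_measurable: "s a \<in> borel_measurable M" "t a \<in> borel_measurable M" if "a \<in> ?I" for a
  proof -
    obtain i k where a: "a = (i, k)" "i \<le> n"
      using \<open>a \<in> ?I\<close> by auto
    have "s a \<in> borel_measurable M \<and> t a \<in> borel_measurable M"
    proof (cases "i = 0")
      case True
      then show ?thesis
        by (simp add: a s_def[abs_def] t_def[abs_def] scan_candidate_def)
    next
      case False
      then have [measurable]: "p i \<in> borel_measurable M"
        using p a by simp
      show ?thesis
        using False by (simp add: a s_def[abs_def] t_def[abs_def] scan_candidate_def)
    qed
    then show "s a \<in> borel_measurable M" "t a \<in> borel_measurable M"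
      by auto
  qed
  have fin: "finite I0"
    using I0 finite_subset by blast
  have V_measurable: "(\<lambda>\<omega>. real (true_null_count I0 (\<lambda>i. p i \<omega>) (s a \<omega>) (t a \<omega>)))
      \<in> borel_measurable M" if "a \<in> ?I" for a
    unfolding true_null_count_def using st_measurable[OF that] I0 fin
    by (intro borel_measurable_interval_count p) auto
  have S_measurable: "(\<lambda>\<omega>. real (false_null_count n I0 (\<lambda>i. p i \<omega>) (s a \<omega>) (t a \<omega>)))
      \<in> borel_measurable M" if "a \<in> ?I" for a
    unfolding false_null_count_def using st_measurable[OF that]
    by (intro borel_measurable_interval_count p) auto
  have feas_measurable: "Measurable.pred M (feas a)" if "a \<in> ?I" for a
  proof -
    note [measurable] = V_measurable[OF that] S_measurable[OF that] st_measurable[OF that]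
    have "Measurable.pred M (\<lambda>\<omega>. 0 \<le> s a \<omega> \<and> s a \<omega> \<le> t a \<omega> \<and> t a \<omega> \<le> 1 \<and>
      real n * (t a \<omega> - s a \<omega>) \<le> \<alpha> *
        max (real (true_null_count I0 (\<lambda>i. p i \<omega>) (s a \<omega>) (t a \<omega>)) +
          real (false_null_count n I0 (\<lambda>i. p i \<omega>) (s a \<omega>) (t a \<omega>))) 1)"
      by measurable
    then show ?thesis
      unfolding feas_def[abs_def] scan_feasible_iff[OF n] rejection_count_def of_nat_max of_nat_add
        of_nat_1 .
  qed
  have E_sets: "E a \<in> sets M" if "a \<in> ?I" for a
  proof -
    have "Measurable.pred M (\<lambda>\<omega>. feas b \<omega> \<longrightarrow>
      t b \<omega> - s b \<omega> \<le> t a \<omega> - s a \<omega> \<and> (t b \<omega> - s b \<omega> = t a \<omega> - s a \<omega> \<longrightarrow> s a \<omega> \<le> s b \<omega>))"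
      if "b \<in> ?I" for b
    proof -
      note [measurable] = st_measurable[OF \<open>a \<in> ?I\<close>] st_measurable[OF that] feas_measurable[OF that]
      show ?thesis
        by measurable
    qed
    then have [measurable]: "Measurable.pred M (\<lambda>\<omega>. \<forall>b\<in>?I. feas b \<omega> \<longrightarrow>
      t b \<omega> - s b \<omega> \<le> t a \<omega> - s a \<omega> \<and> (t b \<omega> - s b \<omega> = t a \<omega> - s a \<omega> \<longrightarrow> s a \<omega> \<le> s b \<omega>))"
      by (intro pred_intros_finite) auto
    note [measurable] = feas_measurable[OF that]
    show ?thesis
      unfolding E_def by measurable
  qed
  have scan: "is_scan_interval \<alpha> n I0 (\<lambda>i. p i \<omega>) (fst z) (snd z)"
    if "z = scan_interval \<alpha> n I0 (\<lambda>i. p i \<omega>)" for \<omega> z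
    unfolding that using is_scan_interval_scan_interval[OF I0] \<alpha> by simp
  have candidate: "\<exists>a\<in>?I. scan_interval \<alpha> n I0 (\<lambda>i. p i \<omega>) = (s a \<omega>, t a \<omega>)" for \<omega>
    using scan_interval_is_candidate[OF n \<alpha> I0, of "\<lambda>i. p i \<omega>"]
    by (simp add: s_def t_def del: atLeastAtMost_iff mem_Sigma_iff)
  have cover: "space M \<subseteq> \<Union>(E ` ?I)"
  proof
    fix \<omega> assume \<omega>: "\<omega> \<in> space M"
    obtain a where a: "a \<in> ?I" "scan_interval \<alpha> n I0 (\<lambda>i. p i \<omega>) = (s a \<omega>, t a \<omega>)"
      using candidate by blast
    have "is_scan_interval \<alpha> n I0 (\<lambda>i. p i \<omega>) (s a \<omega>) (t a \<omega>)"
      using scan[of "(s a \<omega>, t a \<omega>)" \<omega>] a(2) by simp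
    then have "\<omega> \<in> E a"
      using \<omega> is_scan_intervalD[of \<alpha> n I0 "\<lambda>i. p i \<omega>" "s a \<omega>" "t a \<omega>"]
      unfolding E_def feas_def by (auto simp: is_scan_interval_def)
    then show "\<omega> \<in> \<Union>(E ` ?I)"
      using a(1) by blast
  qed
  have on_E: "scan_interval \<alpha> n I0 (\<lambda>i. p i \<omega>) = (s a \<omega>, t a \<omega>)" if "\<omega> \<in> E a" for a \<omega>
  proof -
    obtain b where b: "b \<in> ?I" "scan_interval \<alpha> n I0 (\<lambda>i. p i \<omega>) = (s b \<omega>, t b \<omega>)"
      using candidate by blast
    have sb: "is_scan_interval \<alpha> n I0 (\<lambda>i. p i \<omega>) (s b \<omega>) (t b \<omega>)"
      using scan[of "(s b \<omega>, t b \<omega>)" \<omega>] b(2) by simp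
    then have "feas b \<omega>"
      by (simp add: is_scan_interval_def feas_def)
    then have "t b \<omega> - s b \<omega> \<le> t a \<omega> - s a \<omega>"
        "t b \<omega> - s b \<omega> = t a \<omega> - s a \<omega> \<Longrightarrow> s a \<omega> \<le> s b \<omega>"
      using that b(1) unfolding E_def by blast+
    moreover have "t a \<omega> - s a \<omega> \<le> t b \<omega> - s b \<omega>"
        "t a \<omega> - s a \<omega> = t b \<omega> - s b \<omega> \<Longrightarrow> s b \<omega> \<le> s a \<omega>"
      using is_scan_intervalD[OF sb] that unfolding E_def feas_def by auto
    ultimately show ?thesis
      using b(2) by auto
  qed
  show ?thesis
  proof (rule measurable_piecewise_restrict[where C = "E ` ?I"])
    show "countable (E ` ?I)"
      by (intro countable_finite) auto
    show "space M \<subseteq> \<Union>(E ` ?I)"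
      by (rule cover)
    fix \<Omega> assume "\<Omega> \<in> E ` ?I"
    then obtain a where a: "a \<in> ?I" "\<Omega> = E a"
      by blast
    then show "\<Omega> \<inter> space M \<in> sets M"
      using E_sets by auto
    note [measurable] = S_measurable[OF a(1)]
    have "(\<lambda>\<omega>. FNP n I0 (\<lambda>i. p i \<omega>) (s a \<omega>, t a \<omega>)) \<in> borel_measurable M"
      unfolding FNP_def prod.case by measurable
    then have "(\<lambda>\<omega>. FNP n I0 (\<lambda>i. p i \<omega>) (s a \<omega>, t a \<omega>)) \<in> borel_measurable (restrict_space M \<Omega>)"
      by (rule measurable_restrict_space1)
    also have "?this \<longleftrightarrow> (\<lambda>\<omega>. FNP n I0 (\<lambda>i. p i \<omega>) (scan_interval \<alpha> n I0 (\<lambda>i. p i \<omega>)))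
        \<in> borel_measurable (restrict_space M \<Omega>)"
      by (intro measurable_cong) (auto simp: space_restrict_space a(2) on_E)
    finally show "(\<lambda>\<omega>. FNP n I0 (\<lambda>i. p i \<omega>) (scan_interval \<alpha> n I0 (\<lambda>i. p i \<omega>)))
        \<in> borel_measurable (restrict_space M \<Omega>)" .
  qed
qed

section \<open>The limit of the expected FNP\<close>
lemma FNP_bounds:
  assumes "I0 \<subseteq> {1..n}"
  shows "0 \<le> FNP n I0 p z" "FNP n I0 p z \<le> 1"
proof -
  have "real (false_null_count n I0 p (fst z) (snd z)) / real (n - card I0) \<le> 1"
    using false_null_count_le_card[OF assms, of p "fst z" "snd z"]
    by (intro divide_le_eq_1[THEN iffD2]) linarith
  then show "0 \<le> FNP n I0 p z" "FNP n I0 p z \<le> 1"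
    by (simp_all add: FNP_def split_beta)
qed


lemma rejection_proportion_tendsto:
  fixes p :: "nat \<Rightarrow> nat \<Rightarrow> real" and I0 :: "nat \<Rightarrow> nat set"
  assumes I0: "\<And>n. 1 \<le> n \<Longrightarrow> I0 n \<subseteq> {1..n}"
    and \<pi>0: "(\<lambda>n. real (card (I0 n)) / real n) \<longlonglongrightarrow> \<pi>0"
    and V: "(\<lambda>n. real (true_null_count (I0 n) (p n) s t) / real (card (I0 n))) \<longlonglongrightarrow> v"
    and S: "(\<lambda>n. real (false_null_count n (I0 n) (p n) s t) / real (n - card (I0 n))) \<longlonglongrightarrow> w"
  shows "(\<lambda>n. real (rejection_count n (I0 n) (p n) s t) / real n)
    \<longlonglongrightarrow> \<pi>0 * v + (1 - \<pi>0) * w"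
proof (rule Lim_transform_eventually)
  show "(\<lambda>n. real (card (I0 n)) / real n *
        (real (true_null_count (I0 n) (p n) s t) / real (card (I0 n))) +
      (1 - real (card (I0 n)) / real n) *
        (real (false_null_count n (I0 n) (p n) s t) / real (n - card (I0 n))))
    \<longlonglongrightarrow> \<pi>0 * v + (1 - \<pi>0) * w"
    by (intro tendsto_intros \<pi>0 V S)
  show "\<forall>\<^sub>F n in sequentially. real (card (I0 n)) / real n *
        (real (true_null_count (I0 n) (p n) s t) / real (card (I0 n))) +
      (1 - real (card (I0 n)) / real n) *
        (real (false_null_count n (I0 n) (p n) s t) / real (n - card (I0 n))) =
      real (rejection_count n (I0 n) (p n) s t) / real n"
    using eventually_ge_at_top[of "1::nat"]
  proof eventually_elim
    case (elim n)
    note I = I0[OF elim]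
    have c: "card (I0 n) \<le> n"
      by (rule card_true_nulls_le[OF I])
    have cancel: "a / real n * (x / a) = x / real n" if "a = 0 \<longrightarrow> x = 0" for a x :: real
      using that by auto
    have "1 - real (card (I0 n)) / real n = real (n - card (I0 n)) / real n"
      using c elim by (simp add: of_nat_diff diff_divide_distrib)
    moreover have "real (card (I0 n)) = 0 \<longrightarrow> real (true_null_count (I0 n) (p n) s t) = 0"
      using true_null_count_le_card[OF I, of "p n" s t] by simp
    moreover have "real (n - card (I0 n)) = 0 \<longrightarrow>
        real (false_null_count n (I0 n) (p n) s t) = 0"
      using false_null_count_le_card[OF I, of "p n" s t] by linarith
    ultimately show ?case
      by (simp only: cancel rejection_count_def of_nat_add add_divide_distrib)
  qed
qed
lemma AE_all_rational_intervals:
  fixes X :: "real \<Rightarrow> real \<Rightarrow> 'a \<Rightarrow> bool"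
  assumes "\<And>s t. 0 \<le> s \<Longrightarrow> s < t \<Longrightarrow> t \<le> 1 \<Longrightarrow> AE \<omega> in M. X s t \<omega>"
  shows "AE \<omega> in M. \<forall>s\<in>\<rat>. \<forall>t\<in>\<rat>. 0 \<le> s \<longrightarrow> s < t \<longrightarrow> t \<le> 1 \<longrightarrow> X s t \<omega>"
  using assms by (simp add: AE_ball_countable countable_rat)

theorem theorem4:
  fixes M :: "'a measure"
    and P :: "nat \<Rightarrow> nat \<Rightarrow> 'a \<Rightarrow> real"
    and I0 :: "nat \<Rightarrow> nat set"
    and G :: "real \<Rightarrow> real"
    and \<alpha> \<pi>0 \<pi>1 \<beta> \<delta> :: real
  assumes "prob_space M"
    and "0 < \<alpha>" and "\<alpha> < 1"
    and "\<And>n. n \<ge> 1 \<Longrightarrow> prob_space.indep_vars M (\<lambda>_. borel) (P n) {1..n}"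
    and "\<And>n i \<omega>. n \<ge> 1 \<Longrightarrow> i \<in> {1..n} \<Longrightarrow> \<omega> \<in> space M \<Longrightarrow> P n i \<omega> \<in> {0..1}"
    and "\<And>n. n \<ge> 1 \<Longrightarrow> I0 n \<subseteq> {1..n}"
    and "0 < \<pi>0" and "\<pi>0 < 1"
    and "(\<lambda>n. real (card (I0 n)) / real n) \<longlonglongrightarrow> \<pi>0"
    and "mono G" and "continuous_on UNIV G" and "(G \<longlongrightarrow> 0) at_bot" and "(G \<longlongrightarrow> 1) at_top"
    and "\<And>s t. 0 \<le> s \<Longrightarrow> s < t \<Longrightarrow> t \<le> 1 \<Longrightarrow>
      AE \<omega> in M. (\<lambda>n. real (true_null_count (I0 n) (\<lambda>i. P n i \<omega>) s t) / real (card (I0 n)))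
        \<longlonglongrightarrow> t - s"
    and "\<And>s t. 0 \<le> s \<Longrightarrow> s < t \<Longrightarrow> t \<le> 1 \<Longrightarrow>
      AE \<omega> in M. (\<lambda>n. real (false_null_count n (I0 n) (\<lambda>i. P n i \<omega>) s t) / real (n - card (I0 n)))
        \<longlonglongrightarrow> G t - G s"
    and "\<pi>1 = 1 - \<pi>0"
    and "\<beta> = 1 / \<pi>1 * (1 / \<alpha> - \<pi>0)"
    and "\<delta> = limit_length \<alpha> \<pi>0 G"
    and "\<delta> > 0"
    and "\<exists>(s, t) \<in> limit_maximizers \<alpha> \<pi>0 G.
      strictly_decreasing_at (\<lambda>u. FDR_inf \<pi>0 G u t) s \<or>
      strictly_increasing_at (\<lambda>u. FDR_inf \<pi>0 G s u) t"
  shows "(\<lambda>n. prob_space.expectation M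
      (\<lambda>\<omega>. FNP n (I0 n) (\<lambda>i. P n i \<omega>) (scan_interval \<alpha> n (I0 n) (\<lambda>i. P n i \<omega>))))
    \<longlonglongrightarrow> 1 - \<beta> * \<delta>"
proof -
  interpret prob_space M
    by fact
  have "\<forall>\<^sub>F y in at_bot. G y \<le> G x" "\<forall>\<^sub>F y in at_top. G x \<le> G y" for x
    by (rule eventually_mono[OF eventually_le_at_bot[of x]], erule monoD[OF assms(10)])
      (rule eventually_mono[OF eventually_ge_at_top[of x]], erule monoD[OF assms(10)])
  then have G01: "0 \<le> G x" "G x \<le> 1" for x
    using tendsto_upperbound[OF assms(12)] tendsto_lowerbound[OF assms(13)] by auto
  interpret limit_scan_problem \<alpha> \<pi>0 G
    using assms G01(1)[of 0] G01(2)[of 1] by unfold_locales auto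
  note I0 = assms(6)
  let ?f = "\<lambda>n \<omega>. FNP n (I0 n) (\<lambda>i. P n i \<omega>) (scan_interval \<alpha> n (I0 n) (\<lambda>i. P n i \<omega>))"
  have "AE \<omega> in M. \<forall>s\<in>\<rat>. \<forall>t\<in>\<rat>. 0 \<le> s \<longrightarrow> s < t \<longrightarrow> t \<le> 1 \<longrightarrow>
      (\<lambda>n. real (true_null_count (I0 n) (\<lambda>i. P n i \<omega>) s t) / real (card (I0 n))) \<longlonglongrightarrow> t - s"
    by (intro AE_all_rational_intervals assms(14))
  moreover have "AE \<omega> in M. \<forall>s\<in>\<rat>. \<forall>t\<in>\<rat>. 0 \<le> s \<longrightarrow> s < t \<longrightarrow> t \<le> 1 \<longrightarrow>
      (\<lambda>n. real (false_null_count n (I0 n) (\<lambda>i. P n i \<omega>) s t) / real (n - card (I0 n)))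
        \<longlonglongrightarrow> G t - G s"
    by (intro AE_all_rational_intervals assms(15))
  ultimately have lim: "AE \<omega> in M. (\<lambda>n. ?f n \<omega>) \<longlonglongrightarrow> 1 - slope * max_length"
  proof eventually_elim
    case (elim \<omega>)
    have "(\<lambda>n. 1 - real (false_null_count n (I0 n) (\<lambda>i. P n i \<omega>)
          (fst (scan_interval \<alpha> n (I0 n) (\<lambda>i. P n i \<omega>)))
          (snd (scan_interval \<alpha> n (I0 n) (\<lambda>i. P n i \<omega>)))) / real (n - card (I0 n)))
        \<longlonglongrightarrow> 1 - slope * max_length"
      using elim assms(18-20) unfolding mass_def
      by (intro tendsto_intros scan_interval_false_null_proportion_tendsto I0)
        (auto simp: mass_def intro!: rejection_proportion_tendsto I0 assms(9))
    then show ?case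
      by (simp add: FNP_def split_beta)
  qed
  have meas: "?f n \<in> borel_measurable M" if "1 \<le> n" for n
    using assms(2,3) I0[OF that] assms(4)[OF that] that unfolding indep_vars_def
    by (intro borel_measurable_FNP_scan_interval) auto
  \<comment> \<open>The shift is needed because the P-values are random variables only for \<open>n \<ge> 1\<close>.\<close>
  have "(\<lambda>n. expectation (?f (Suc n))) \<longlonglongrightarrow> expectation (\<lambda>\<omega>. 1 - slope * max_length)"
  proof (rule integral_dominated_convergence[where w = "\<lambda>_. 1"])
    show "AE \<omega> in M. (\<lambda>n. ?f (Suc n) \<omega>) \<longlonglongrightarrow> 1 - slope * max_length"
      using lim by eventually_elim (rule LIMSEQ_Suc)
    show "AE \<omega> in M. norm (?f (Suc n) \<omega>) \<le> 1" for n
    proof (rule AE_I2)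
      fix \<omega>
      show "norm (?f (Suc n) \<omega>) \<le> 1"
        using FNP_bounds[OF I0[of "Suc n"]] by (simp add: real_norm_def)
    qed
  qed (use meas in auto)
  then have "(\<lambda>n. expectation (?f n)) \<longlonglongrightarrow> 1 - slope * max_length"
    by (subst (asm) filterlim_sequentially_Suc) (simp add: prob_space)
  then show ?thesis
    using assms(16-18) by (simp add: slope_def)
qed

end
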